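(* Let $(\Omega,F,\eta)$ and $(\Omega,F,\tau)$ be probability spaces, let $f:\Omega\to\Omega^*$ be a measurable mapping from $(\Omega,F)$ into $(\Omega^*,F^* )$, and let $\eta^*$ and $\tau^*$ be the image measures of $\eta$ and $\tau$ under $f$. If there exists a measurable subset $\Omega_0\subset\Omega$ such that $\eta(\Omega_0)=\tau(\Omega_0)=0$ and the mapping $f:(\Omega\setminus\Omega_0)\to\Omega^*$ is a bijection, then $$\eta\ll\tau \text{ if and only if } \eta^*\ll\tau^*,\qquad\text{and}\qquad \eta\perp\tau \text{ if and only if } \eta^*\perp\tau^*.$$
   Context: Here $(\Omega^*,F^* )$ is a measurable space, and the image measures on it are defined by $\eta^*(E)=\eta(f^{-1}(E))$ and $\tau^*(E)=\tau(f^{-1}(E))$ for every $E\in F^*$, where $f^{-1}(E)=\{\omega\in\Omega: f(\omega)\in E\}$. The notation $\ll$ means absolute continuity and $\perp$ means mutual singularity of measures.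
   Formalization: The bijection f from Ω∖Ω₀ onto Ω* is additionally assumed to have a measurable inverse (from F* to the trace of F on Ω∖Ω₀); with a merely set-theoretic bijection both equivalences fail, e.g. for the identity of a two-point space with F* trivial. *)

theory Defs
  imports "HOL-Probability.Probability"
begin

definition mutually_singular :: "'a measure \<Rightarrow> 'a measure \<Rightarrow> bool" where
  "mutually_singular M N \<longleftrightarrow> sets M = sets N \<and>
     (\<exists>A\<in>sets M. emeasure M A = 0 \<and> emeasure N (space N - A) = 0)"

(* The library's absolutely_continuous M N means that N is absolutely continuous
   with respect to M, so the usual "M << N" is absolutely_continuous N M. *)
abbreviation abs_cont_wrt :: "'a measure \<Rightarrow> 'a measure \<Rightarrow> bool" where
  "abs_cont_wrt M N \<equiv> absolutely_continuous N M"

end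

theory Submission
  imports Defs
begin

(* Off the null set the map f is an isomorphism of measurable spaces. Hence, up to null sets, every
   measurable set A is the preimage of a measurable set E, so the image measures of E and of its
   complement are the measures of A and of its complement. *)

text \<open>Removing the null set \<open>Z\<close> changes neither the measure of the preimage of
  \<open>E\<close> nor that of \<open>A\<close>, and what remains of the two sets coincides.\<close>

lemma emeasure_distr_eq_off_null_set:
  assumes "f \<in> measurable M N" and "A \<in> sets M" and "E \<in> sets N" and "Z \<in> null_sets M"
    and "(f -` E \<inter> space M) - Z = A - Z"
  shows "emeasure (distr M N f) E = emeasure M A"
proof -
  have "f -` E \<inter> space M \<in> sets M"
    using assms(1,3) by (rule measurable_sets)
  then have "emeasure M (f -` E \<inter> space M) = emeasure M A"
    using assms(2,4,5) by (metis emeasure_Diff_null_set)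
  then show ?thesis
    using assms(1,3) by (simp add: emeasure_distr)
qed

text \<open>The witness is the preimage of \<open>A - Z\<close> under the inverse of
  \<open>f\<close>. Outside \<open>Z\<close> the inverse takes \<open>f x\<close> back to
  \<open>x\<close>, so \<open>f x\<close> lies in the witness exactly when \<open>x\<close> lies in
  \<open>A\<close>.\<close>

lemma exists_measurable_preimage_of_bij_betw:
  assumes "A \<in> sets M" and "Z \<in> sets M"
    and bij: "bij_betw f (space M - Z) (space N)"
    and inv: "the_inv_into (space M - Z) f \<in> measurable N (restrict_space M (space M - Z))"
  obtains E where "E \<in> sets N" and "(f -` E \<inter> space M) - Z = A - Z"
proof
  let ?g = "the_inv_into (space M - Z) f"
  have "A - Z \<in> sets (restrict_space M (space M - Z))"
    using assms(1,2) sets.sets_into_space[OF assms(1)]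
    by (subst sets_restrict_space_iff) auto
  with inv show "?g -` (A - Z) \<inter> space N \<in> sets N"
    by (rule measurable_sets)
  have "?g (f x) = x" "f x \<in> space N" if "x \<in> space M - Z" for x
    using bij that by (auto simp: bij_betw_def the_inv_into_f_f)
  then show "(f -` (?g -` (A - Z) \<inter> space N) \<inter> space M) - Z = A - Z"
    using sets.sets_into_space[OF assms(1)] by auto
qed

(* The measurability of the inverse, inv_measurable, is part of what "bijection" has to mean
   between measurable spaces: with a merely set-theoretic bijection the claim fails, e.g. for
   f the identity from a two-point space with its power set to the same set with the trivial
   sigma-algebra and for eta, tau the two point masses. *)
theorem theorem6:
  fixes \<eta> \<tau> :: "'a measure" and Fs :: "'b measure" and f :: "'a \<Rightarrow> 'b" and \<Omega>\<^sub>0 :: "'a set"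
  assumes "prob_space \<eta>" and "prob_space \<tau>"
    and "sets \<eta> = sets \<tau>"
    and "f \<in> measurable \<eta> Fs"
    and "\<Omega>\<^sub>0 \<in> sets \<eta>" and "emeasure \<eta> \<Omega>\<^sub>0 = 0" and "emeasure \<tau> \<Omega>\<^sub>0 = 0"
    and "bij_betw f (space \<eta> - \<Omega>\<^sub>0) (space Fs)"
    and inv_measurable:
      "the_inv_into (space \<eta> - \<Omega>\<^sub>0) f \<in> measurable Fs (restrict_space \<eta> (space \<eta> - \<Omega>\<^sub>0))"
  shows "(abs_cont_wrt \<eta> \<tau> \<longleftrightarrow> abs_cont_wrt (distr \<eta> Fs f) (distr \<tau> Fs f)) \<and>
         (mutually_singular \<eta> \<tau> \<longleftrightarrow> mutually_singular (distr \<eta> Fs f) (distr \<tau> Fs f))"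
proof -
  let ?D = "\<lambda>\<mu>. distr \<mu> Fs f"
  have space_eq: "space \<tau> = space \<eta>"
    using \<open>sets \<eta> = sets \<tau>\<close> by (metis sets_eq_imp_space_eq)
  have \<tau>_meas: "f \<in> measurable \<tau> Fs"
    using assms(3,4) by (simp cong: measurable_cong_sets)
  have null: "\<Omega>\<^sub>0 \<in> null_sets \<eta>" "\<Omega>\<^sub>0 \<in> null_sets \<tau>"
    using assms(3,5-7) by auto
  \<comment> \<open>A single \<open>E\<close> has to serve both measures at once. The equation for
    complements is there for singularity.\<close>
  have corresp: "\<exists>E\<in>sets Fs. emeasure (?D \<eta>) E = emeasure \<eta> A \<and> emeasure (?D \<tau>) E = emeasure \<tau> A \<and>
      emeasure (?D \<tau>) (space Fs - E) = emeasure \<tau> (space \<tau> - A)"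
    if A: "A \<in> sets \<eta>" for A
  proof -
    obtain E where E: "E \<in> sets Fs" "(f -` E \<inter> space \<eta>) - \<Omega>\<^sub>0 = A - \<Omega>\<^sub>0"
      using A assms(5,8,9) by (rule exists_measurable_preimage_of_bij_betw)
    \<comment> \<open>Preimages under \<open>f\<close> commute with complements, so the match off
      \<open>\<Omega>\<^sub>0\<close> passes to complements.\<close>
    have "(f -` (space Fs - E) \<inter> space \<eta>) - \<Omega>\<^sub>0 = (space \<eta> - A) - \<Omega>\<^sub>0"
      using E(2) measurable_space[OF assms(4)] by blast
    then show ?thesis
      using A E assms(3,4) \<tau>_meas null space_eq
      by (intro bexI[of _ E] conjI emeasure_distr_eq_off_null_set[where Z = \<Omega>\<^sub>0]) auto
  qed
  have "abs_cont_wrt \<eta> \<tau> \<longleftrightarrow> abs_cont_wrt (?D \<eta>) (?D \<tau>)"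
  proof
    assume ac: "abs_cont_wrt \<eta> \<tau>"
    \<comment> \<open>The null sets of an image measure are the measurable sets with null
      preimage.\<close>
    show "abs_cont_wrt (?D \<eta>) (?D \<tau>)"
      using ac assms(4) \<tau>_meas
      by (auto simp: absolutely_continuous_def null_sets_distr_iff space_eq)
  next
    assume ac: "abs_cont_wrt (?D \<eta>) (?D \<tau>)"
    show "abs_cont_wrt \<eta> \<tau>"
      unfolding absolutely_continuous_def
    proof
      fix A assume A: "A \<in> null_sets \<tau>"
      then have A_sets: "A \<in> sets \<eta>"
        using assms(3) by auto
      \<comment> \<open>Nullity of \<open>A\<close> moves to \<open>E\<close>, crosses from the
        image of \<tau> to that of \<eta>, and returns to \<open>A\<close>.\<close>
      obtain E where "E \<in> sets Fs" "emeasure (?D \<eta>) E = emeasure \<eta> A" "emeasure (?D \<tau>) E = emeasure \<tau> A"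
        using corresp[OF A_sets] by blast
      then show "A \<in> null_sets \<eta>"
        using A A_sets ac by (auto simp: absolutely_continuous_def null_sets_def)
    qed
  qed
  moreover have "mutually_singular \<eta> \<tau> \<longleftrightarrow> mutually_singular (?D \<eta>) (?D \<tau>)"
  proof
    assume "mutually_singular \<eta> \<tau>"
    then obtain A where "A \<in> sets \<eta>" "emeasure \<eta> A = 0" "emeasure \<tau> (space \<tau> - A) = 0"
      by (auto simp: mutually_singular_def)
    then show "mutually_singular (?D \<eta>) (?D \<tau>)"
      using corresp[of A] by (auto simp: mutually_singular_def)
  next
    assume "mutually_singular (?D \<eta>) (?D \<tau>)"
    then obtain E where E: "E \<in> sets Fs" "emeasure (?D \<eta>) E = 0" "emeasure (?D \<tau>) (space Fs - E) = 0"
      by (auto simp: mutually_singular_def)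
    \<comment> \<open>The preimage of \<open>E\<close> separates \<eta> and \<tau>, its complement
      being the preimage of \<open>space Fs - E\<close>.\<close>
    have "space \<tau> - (f -` E \<inter> space \<eta>) = f -` (space Fs - E) \<inter> space \<tau>"
      using measurable_space[OF \<tau>_meas] by (auto simp: space_eq)
    moreover have "f -` E \<inter> space \<eta> \<in> sets \<eta>"
      using assms(4) E(1) by (rule measurable_sets)
    ultimately show "mutually_singular \<eta> \<tau>"
      using E assms(3,4) \<tau>_meas
      by (auto simp: mutually_singular_def emeasure_distr
          intro!: bexI[of _ "f -` E \<inter> space \<eta>"])
  qed
  ultimately show ?thesis ..
qed

end
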